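(* Let $V(\bar x)$ denote the optimal value of the semi-infinite program $$\inf_{\Theta\in\Xi}\ \bigl\{J_1(\Theta\Phi(\cdot)) : \psi(x_\Theta(T;\alpha))\le 0\ \text{for all }\alpha\in\mathcal{A}\bigr\}$$ with initial state $\bar x\in\mathbb{R}^d$, and let $X_T=\{\bar x\in\mathbb{R}^d: V(\bar x)<+\infty\}$, assumed nonempty. Fix $\bar x\in X_T$ and suppose that the program is strictly feasible, i.e. there exists $\Theta\in\Xi$ such that $\psi(x_\Theta(T;\alpha))<0$ for all $\alpha\in\mathcal{A}$. For $\boldsymbol\alpha=(\alpha^1,\dots,\alpha^N)\in\mathcal{A}^N$, where $N$ is the dimension of the decision space (the number of components of $\Theta$), define $$G(\bar x;\boldsymbol\alpha)=\inf_{\Theta\in\Xi}\bigl\{J_1(\Theta\Phi(\cdot)):\psi(x_\Theta(T;\alpha^i))\le 0\ \text{for } i=1,\dots,N\bigr\}.$$ Then the map $\mathcal{A}^N\ni\boldsymbol\alpha\mapsto G(\bar x;\boldsymbol\alpha)\in\mathbb{R}$ is continuous, there exists $\boldsymbol\alpha^*(\bar x)\in\mathcal{A}^N$ that solves $$\sup_{\boldsymbol\alpha\in\mathcal{A}^N}G(\bar x;\boldsymbol\alpha),$$ and moreover $V(\bar x)=G(\bar x;\boldsymbol\alpha^*(\bar x))$.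
   Context: Setting. Let $d,\nu\in\mathbb{N}$ and $T>0$ be fixed. $\mathcal{A}\subset\mathbb{R}^\nu$ is a nonempty, compact, convex set of uncertain parameters. The maps $\alpha\mapsto A(\alpha)\in\mathbb{R}^{d\times d}$ and $\alpha\mapsto b(\alpha)\in\mathbb{R}^d$ are continuously differentiable on an open neighbourhood of $\mathcal{A}$. The function $\psi:\mathbb{R}^d\to\mathbb{R}$ is continuously differentiable and convex, and $C=\{\xi:\psi(\xi)\le0\}$ is compact and convex. Control parametrization. Fix a step $h>0$ and a grid $0=t_0<t_1<\cdots<t_K\le T$ with $t_i-t_{i-1}=h$ for $i=1,\dots,K$ and $T-t_K\le h$. Let $N\in\mathbb{N}$ and let $\phi_1,\dots,\phi_N:[0,T]\to\mathbb{R}$ be linearly independent functions that are constant on each $[t_{k-1},t_k)$, $k=1,\dots,K$, and on $[t_K,T]$, normalized by $\max_i\max_t|\phi_i(t)|=1$. Put $\Phi(t)=(\phi_1(t),\dots,\phi_N(t))^\top\in\mathbb{R}^N$. For $\Theta\in\mathbb{R}^{1\times N}$ and initial state $\bar x$, $$x_\Theta(t;\alpha)=e^{A(\alpha)t}\bar x+\int_0^t e^{A(\alpha)(t-\tau)}b(\alpha)\,\Theta\Phi(\tau)\,d\tau,\qquad J_1(\Theta\Phi(\cdot))=\int_0^T|\Theta\Phi(t)|\,dt,$$ and $\Xi=\{\Theta\in\mathbb{R}^{1\times N}:\Theta\Phi(t)\in[-1,1]\ \text{for all }t\in[0,T]\}$. By convention the infimum over an empty set is $+\infty$. *)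

theory Defs
  imports "HOL-Analysis.Analysis"
begin

(* The classes behind exp and (^) give componentwise operations on the vec type
   (and exp is not available there at all), so the matrix exponential is the
   power series built from the matrix product. *)
definition mat_exp :: "real^'d^'d \<Rightarrow> real^'d^'d" where
  "mat_exp M = (\<Sum>k. (((**) M ^^ k) (mat 1)) /\<^sub>R fact k)"

definition C1_on ::
    "('a::real_normed_vector \<Rightarrow> 'b::real_normed_vector) \<Rightarrow> 'a set \<Rightarrow> bool" where
  "C1_on f U \<longleftrightarrow>
     (\<exists>f' :: 'a \<Rightarrow> 'a \<Rightarrow>\<^sub>L 'b.
        (\<forall>x\<in>U. (f has_derivative blinfun_apply (f' x)) (at x)) \<and> continuous_on U f')"

definition lin_indep_on :: "real set \<Rightarrow> ('N::finite \<Rightarrow> real \<Rightarrow> real) \<Rightarrow> bool" where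
  "lin_indep_on S \<phi> \<longleftrightarrow>
     (\<forall>c. (\<forall>t\<in>S. (\<Sum>i\<in>UNIV. c i * \<phi> i t) = 0) \<longrightarrow> (\<forall>i. c i = 0))"

definition Phi :: "('N::finite \<Rightarrow> real \<Rightarrow> real) \<Rightarrow> real \<Rightarrow> real^'N" where
  "Phi \<phi> t = (\<chi> i. \<phi> i t)"

(* The control t |-> \<Theta> \<Phi>(t): a row matrix \<Theta> with N columns is a vector in real^'N,
   and its product with the column \<Phi>(t) is the inner product. *)
definition ctrl :: "('N::finite \<Rightarrow> real \<Rightarrow> real) \<Rightarrow> real^'N \<Rightarrow> real \<Rightarrow> real" where
  "ctrl \<phi> \<Theta> t = \<Theta> \<bullet> Phi \<phi> t"

definition traj ::
    "('p \<Rightarrow> real^'d^'d) \<Rightarrow> ('p \<Rightarrow> real^'d) \<Rightarrow> ('N::finite \<Rightarrow> real \<Rightarrow> real) \<Rightarrow>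
     real^'d \<Rightarrow> real^'N \<Rightarrow> real \<Rightarrow> 'p \<Rightarrow> real^'d" where
  "traj A b \<phi> x0 \<Theta> t \<alpha> =
     mat_exp (t *\<^sub>R A \<alpha>) *v x0
     + integral {0..t} (\<lambda>\<tau>. ctrl \<phi> \<Theta> \<tau> *\<^sub>R (mat_exp ((t - \<tau>) *\<^sub>R A \<alpha>) *v b \<alpha>))"

definition J1 :: "real \<Rightarrow> (real \<Rightarrow> real) \<Rightarrow> real" where
  "J1 T u = integral {0..T} (\<lambda>t. \<bar>u t\<bar>)"

definition Xi :: "real \<Rightarrow> ('N::finite \<Rightarrow> real \<Rightarrow> real) \<Rightarrow> (real^'N) set" where
  "Xi T \<phi> = {\<Theta>. \<forall>t\<in>{0..T}. ctrl \<phi> \<Theta> t \<in> {-1..1}}"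

(* Optimal values are extended reals, so that the infimum over the empty set is \<infinity>. *)
definition V ::
    "real \<Rightarrow> ('p \<Rightarrow> real^'d^'d) \<Rightarrow> ('p \<Rightarrow> real^'d) \<Rightarrow> (real^'d \<Rightarrow> real) \<Rightarrow> 'p set \<Rightarrow>
     ('N::finite \<Rightarrow> real \<Rightarrow> real) \<Rightarrow> real^'d \<Rightarrow> ereal" where
  "V T A b \<psi> \<A> \<phi> x0 =
     (INF \<Theta>\<in>{\<Theta> \<in> Xi T \<phi>. \<forall>\<alpha>\<in>\<A>. \<psi> (traj A b \<phi> x0 \<Theta> T \<alpha>) \<le> 0}. ereal (J1 T (ctrl \<phi> \<Theta>)))"

definition X_T ::
    "real \<Rightarrow> ('p \<Rightarrow> real^'d^'d) \<Rightarrow> ('p \<Rightarrow> real^'d) \<Rightarrow> (real^'d \<Rightarrow> real) \<Rightarrow> 'p set \<Rightarrow>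
     ('N::finite \<Rightarrow> real \<Rightarrow> real) \<Rightarrow> (real^'d) set" where
  "X_T T A b \<psi> \<A> \<phi> = {x0. V T A b \<psi> \<A> \<phi> x0 < \<infinity>}"

(* The tuple of scenarios has the same index type 'N as the decision vector \<Theta>. *)
definition G ::
    "real \<Rightarrow> ('p \<Rightarrow> real^'d^'d) \<Rightarrow> ('p \<Rightarrow> real^'d) \<Rightarrow> (real^'d \<Rightarrow> real) \<Rightarrow>
     ('N::finite \<Rightarrow> real \<Rightarrow> real) \<Rightarrow> real^'d \<Rightarrow> 'p^'N \<Rightarrow> ereal" where
  "G T A b \<psi> \<phi> x0 \<alpha>s =
     (INF \<Theta>\<in>{\<Theta> \<in> Xi T \<phi>. \<forall>i. \<psi> (traj A b \<phi> x0 \<Theta> T (\<alpha>s $ i)) \<le> 0}. ereal (J1 T (ctrl \<phi> \<Theta>)))"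

definition tuples :: "'p set \<Rightarrow> ('p^'N::finite) set" where
  "tuples \<A> = {\<alpha>s. \<forall>i. \<alpha>s $ i \<in> \<A>}"

end

theory Submission
  imports Defs
begin

text \<open>
  Two facts about convex programs carry the proof. The first is Helly's theorem. All constraint sets
  of the program, and the sublevel sets of the objective, are compact and convex subsets of an
  \<open>N\<close>-dimensional space. If the robust value exceeded a number \<open>c\<close>, then the sublevel set at height \<open>c\<close>
  and the constraint sets would have no common point, and already some
  \<open>N + 1\<close> or fewer of them would have none. The sublevel set must be among these, since the full program is feasible; hence at most \<open>N\<close>
  constraints already force the value above \<open>c\<close>. Therefore the robust value is at most the supremum
  of the values with \<open>N\<close> scenarios, and it is at least that because dropping constraints can only lower a minimum
  (\<open>opt_le_if_small\<close>, \<open>optimal_scenario\<close>).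

  The second is that the value with \<open>N\<close> scenarios depends continuously on them, so that the supremum
  is attained on the compact set of tuples (\<open>continuous_on_scenario_opt\<close>). Lower semicontinuity comes
  from compactness of the set of decisions. Upper semicontinuity comes from strict feasibility: by
  convexity a minimiser can be moved slightly towards a strictly feasible decision, and the point
  obtained stays feasible when the scenarios are perturbed (\<open>opt_less_iff\<close>).

  These arguments are carried out for an abstract program, in the locale \<open>compact_convex_program\<close>. What
  remains is to see that the control problem is an instance. The set of admissible \<open>\<Theta>\<close> is compact
  because the basis functions are linearly independent (\<open>compact_Xi\<close>). The cost is convex on the whole
  space, hence continuous (\<open>convex_on_J1\<close>). The terminal state is affine in \<open>\<Theta>\<close>
  (\<open>traj_eq\<close>) and jointly continuous in \<open>\<Theta>\<close> and the parameter (\<open>continuous_on_traj\<close>); the latter rests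
  on continuity of the matrix exponential (\<open>continuous_on_mat_exp\<close>) and on integrating continuous
  functions against step functions.
\<close>


section \<open>Auxiliary facts from topology and convexity\<close>

lemma compact_tuples:
  fixes P :: "'p::euclidean_space set"
  assumes "compact P"
  shows "compact (tuples P :: ('p^'n::finite) set)"
proof -
  have "closed (tuples P :: ('p^'n) set)"
    unfolding tuples_def Collect_all_eq
    by (intro closed_INT ballI closed_vimage[of P, unfolded vimage_def] compact_imp_closed assms
        continuous_on_component continuous_on_id)
  moreover obtain r where r: "\<And>p. p \<in> P \<Longrightarrow> norm p \<le> r"
    using compact_imp_bounded[OF assms] by (auto simp: bounded_iff)
  have "norm a \<le> (\<Sum>i\<in>(UNIV :: 'n set). r)" if "a \<in> tuples P" for a :: "'p^'n"
    unfolding norm_vec_def using that r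
    by (intro order_trans[OF L2_set_le_sum] sum_mono) (auto simp: tuples_def)
  hence "bounded (tuples P :: ('p^'n) set)"
    by (auto simp: bounded_iff)
  ultimately show ?thesis
    by (simp add: compact_eq_bounded_closed)
qed

text \<open>Half-lines generate the topology of the real line. The two halves of the hypothesis match the two
  ways in which optimal values are controlled below: strict bounds by interior points of the
  constraints, weak bounds by compactness.\<close>

lemma continuous_on_halflinesI:
  fixes v :: "'a::topological_space \<Rightarrow> real"
  assumes "\<And>c. openin (top_of_set X) {x\<in>X. v x < c}"
    and "\<And>c. closedin (top_of_set X) {x\<in>X. v x \<le> c}"
  shows "continuous_on X v"
  unfolding continuous_on_def
proof (intro ballI order_tendstoI)
  fix x c assume x: "x \<in> X"
  have ev: "eventually (\<lambda>y. y \<in> U) (at x within X)" if "openin (top_of_set X) U" "x \<in> U" for U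
    using that unfolding openin_open eventually_at_topological by blast
  show "\<forall>\<^sub>F y in at x within X. v y < c" if "v x < c"
    using ev[OF assms(1)[of c]] x that by (auto elim: eventually_mono)
  have "X - {x\<in>X. v x \<le> c} = {x\<in>X. c < v x}" by auto
  hence "openin (top_of_set X) {x\<in>X. c < v x}"
    using assms(2)[of c] unfolding closedin_def by simp
  from ev[OF this] show "\<forall>\<^sub>F y in at x within X. c < v y" if "c < v x"
    using x that by (auto elim: eventually_mono)
qed

text \<open>Compactness reduces an arbitrary family to its finite subfamilies. Asking for all subfamilies of at
  most \<open>DIM('a) + 1\<close> members, not of exactly that many, also covers families with fewer members.\<close>

lemma Helly_compact:
  fixes \<F> :: "'a::euclidean_space set set"
  assumes comp: "\<And>C. C \<in> \<F> \<Longrightarrow> compact C" and conv: "\<And>C. C \<in> \<F> \<Longrightarrow> convex C"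
    and small: "\<And>\<G>. \<lbrakk>\<G> \<subseteq> \<F>; finite \<G>; card \<G> \<le> DIM('a) + 1\<rbrakk> \<Longrightarrow> \<Inter>\<G> \<noteq> {}"
  shows "\<Inter>\<F> \<noteq> {}"
proof (rule compact_fip_Heine_Borel[OF comp])
  fix \<F>' assume F': "finite \<F>'" "\<F>' \<subseteq> \<F>"
  show "\<Inter>\<F>' \<noteq> {}"
  proof (cases "card \<F>' \<le> DIM('a) + 1")
    case True
    thus ?thesis using small F' by blast
  next
    case False
    show ?thesis
    proof (rule Helly)
      show "DIM('a) + 1 \<le> card \<F>'" using False by simp
      show "\<forall>s\<in>\<F>'. convex s" using conv F' by blast
      fix \<G> assume "\<G> \<subseteq> \<F>'" "card \<G> = DIM('a) + 1"
      thus "\<Inter>\<G> \<noteq> {}" using F' finite_subset by (intro small) auto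
    qed
  qed
qed

section \<open>Compact convex programs with a continuum of constraints\<close>

locale compact_convex_program =
  fixes S :: "'e::euclidean_space set" and f :: "'e \<Rightarrow> real"
    and P :: "'p::euclidean_space set" and g :: "'e \<Rightarrow> 'p \<Rightarrow> real"
  assumes compact_S: "compact S" and convex_S: "convex S"
    and cont_f: "continuous_on S f" and convex_f: "convex_on S f"
    and compact_P: "compact P" and P_nonempty: "P \<noteq> {}"
    and cont_g: "continuous_on (S \<times> P) (\<lambda>(x, p). g x p)"
    and convex_g: "\<And>p. p \<in> P \<Longrightarrow> convex_on S (\<lambda>x. g x p)"
    and slater: "\<exists>x\<in>S. \<forall>p\<in>P. g x p < 0"
begin

definition feasible :: "'p set \<Rightarrow> 'e set" where
  "feasible B = {x \<in> S. \<forall>p\<in>B. g x p \<le> 0}"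

definition opt :: "'p set \<Rightarrow> ereal" where
  "opt B = (INF x\<in>feasible B. ereal (f x))"

lemma continuous_on_decision: "p \<in> P \<Longrightarrow> continuous_on S (\<lambda>x. g x p)"
  by (rule continuous_on_compose2[OF cont_g, of S "\<lambda>x. (x, p)", unfolded case_prod_conv])
    (auto intro!: continuous_intros)

lemma continuous_on_parameter: "x \<in> S \<Longrightarrow> continuous_on P (g x)"
  by (rule continuous_on_compose2[OF cont_g, of P "\<lambda>p. (x, p)", unfolded case_prod_conv])
    (auto intro!: continuous_intros)

lemma compact_sublevel:
  assumes "continuous_on S u" shows "compact {x \<in> S. u x \<le> (c::real)}"
proof -
  have "closed {x \<in> S. u x \<le> c}"
    using continuous_on_closed_Collect_le[OF assms continuous_on_const compact_imp_closed[OF compact_S]] .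
  thus ?thesis
    using compact_Int_closed[OF compact_S, of "{x \<in> S. u x \<le> c}"] by (simp add: Int_def conj_ac)
qed

lemma convex_sublevel:
  assumes "convex_on S u" shows "convex {x \<in> S. u x \<le> (c::real)}"
proof (rule convexI)
  fix x y :: 'e and s t :: real
  assume *: "x \<in> {x \<in> S. u x \<le> c}" "y \<in> {x \<in> S. u x \<le> c}" "0 \<le> s" "0 \<le> t" "s + t = 1"
  have "s * u x + t * u y \<le> s * c + t * c"
    using * by (intro add_mono mult_left_mono) auto
  also have "\<dots> = c" using * by (metis distrib_right mult_1)
  finally have "s * u x + t * u y \<le> c" .
  moreover have "u (s *\<^sub>R x + t *\<^sub>R y) \<le> s * u x + t * u y"
    using assms * unfolding convex_on_def by blast
  moreover have "s *\<^sub>R x + t *\<^sub>R y \<in> S" using * convexD[OF convex_S] by blast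
  ultimately show "s *\<^sub>R x + t *\<^sub>R y \<in> {x \<in> S. u x \<le> c}" by simp
qed

lemma feasible_nonempty: "B \<subseteq> P \<Longrightarrow> feasible B \<noteq> {}"
  using slater unfolding feasible_def by (blast intro: less_imp_le)

lemma compact_feasible: assumes "B \<subseteq> P" shows "compact (feasible B)"
proof -
  have "feasible B = S \<inter> (\<Inter>p\<in>B. {x \<in> S. g x p \<le> 0})"
    by (auto simp: feasible_def)
  moreover have "closed (\<Inter>p\<in>B. {x \<in> S. g x p \<le> 0})"
    using assms by (intro closed_INT ballI compact_imp_closed compact_sublevel continuous_on_decision) auto
  ultimately show ?thesis using compact_S by (simp add: compact_Int_closed)
qed

lemma opt_attained:
  assumes "B \<subseteq> P" obtains x where "x \<in> feasible B" "opt B = ereal (f x)"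
proof -
  have "continuous_on (feasible B) f"
    by (rule continuous_on_subset[OF cont_f]) (auto simp: feasible_def)
  from continuous_attains_inf[OF compact_feasible feasible_nonempty this, OF assms assms]
  obtain x where x: "x \<in> feasible B" "\<And>y. y \<in> feasible B \<Longrightarrow> f x \<le> f y" by blast
  have "opt B = ereal (f x)"
    unfolding opt_def using x by (intro antisym INF_lower INF_greatest) auto
  thus ?thesis using that x by blast
qed

lemma opt_mono: "B \<subseteq> C \<Longrightarrow> opt B \<le> opt C"
  unfolding opt_def feasible_def by (rule INF_superset_mono) auto

lemma opt_le_iff:
  assumes "B \<subseteq> P" shows "opt B \<le> ereal c \<longleftrightarrow> (\<exists>x\<in>feasible B. f x \<le> c)"
proof
  assume "opt B \<le> ereal c"
  thus "\<exists>x\<in>feasible B. f x \<le> c" using opt_attained[OF assms] by (metis ereal_less_eq(3))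
next
  assume "\<exists>x\<in>feasible B. f x \<le> c"
  thus "opt B \<le> ereal c" unfolding opt_def by (auto intro: INF_lower2)
qed

text \<open>Strict feasibility lets one trade an arbitrarily small loss in the objective for strict constraints:
  moving from a minimiser a little towards the Slater point makes every constraint strict, by
  convexity, and changes the objective little. Strict constraints survive a small change of the
  parameters, so this characterisation makes the value upper semicontinuous.\<close>

lemma opt_less_iff:
  assumes "B \<subseteq> P" shows "opt B < ereal c \<longleftrightarrow> (\<exists>x\<in>S. f x < c \<and> (\<forall>p\<in>B. g x p < 0))"
proof
  assume less: "opt B < ereal c"
  obtain x where x: "x \<in> feasible B" "opt B = ereal (f x)" using opt_attained[OF assms] .
  obtain z where z: "z \<in> S" "\<And>p. p \<in> P \<Longrightarrow> g z p < 0" using slater by blast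
  have fx: "f x < c" using less x by simp
  \<comment> \<open>the segment from the minimiser \<open>x\<close> to the Slater point \<open>z\<close>\<close>
  define y where "y s = (1 - s) *\<^sub>R x + s *\<^sub>R z" for s :: real
  have "((\<lambda>s. (1 - s) * f x + s * f z) \<longlongrightarrow> (1 - 0) * f x + 0 * f z) (at_right 0)"
    by (intro tendsto_intros)
  hence "\<forall>\<^sub>F s in at_right 0. (1 - s) * f x + s * f z < c"
    using fx by (intro order_tendstoD) auto
  moreover have "\<forall>\<^sub>F s in at_right (0::real). 0 < s \<and> s < 1"
    by (auto simp: eventually_at_right_field intro: exI[of _ 1])
  ultimately have "\<forall>\<^sub>F s in at_right 0. (1 - s) * f x + s * f z < c \<and> 0 < s \<and> s < 1"
    by eventually_elim simp
  then obtain s where s: "(1 - s) * f x + s * f z < c" "0 < s" "s < 1"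
    using eventually_happens'[OF trivial_limit_at_right_real] by blast
  have xS: "x \<in> S" and gx: "\<And>p. p \<in> B \<Longrightarrow> g x p \<le> 0" using x by (auto simp: feasible_def)
  have "y s \<in> S"
    unfolding y_def using convexD[OF convex_S xS z(1)] s by simp
  moreover have "f (y s) \<le> (1 - s) * f x + s * f z"
    unfolding y_def using convex_onD[OF convex_f] s xS z by simp
  hence "f (y s) < c" using s by simp
  moreover have "g (y s) p < 0" if p: "p \<in> B" for p
  proof -
    have "g (y s) p \<le> (1 - s) * g x p + s * g z p"
      unfolding y_def using convex_onD[OF convex_g] s xS z p assms by auto
    also have "\<dots> < 0"
      using gx[OF p] z(2)[of p] p assms s
      by (intro add_nonpos_neg mult_nonneg_nonpos mult_pos_neg) auto
    finally show ?thesis .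
  qed
  ultimately show "\<exists>x\<in>S. f x < c \<and> (\<forall>p\<in>B. g x p < 0)" by blast
next
  assume "\<exists>x\<in>S. f x < c \<and> (\<forall>p\<in>B. g x p < 0)"
  then obtain x where "x \<in> S" "f x < c" "\<And>p. p \<in> B \<Longrightarrow> g x p < 0" by blast
  hence "x \<in> feasible B" by (force simp: feasible_def)
  hence "opt B \<le> ereal (f x)" unfolding opt_def by (rule INF_lower)
  thus "opt B < ereal c" using \<open>f x < c\<close> by (simp add: le_less_trans)
qed

text \<open>The Helly step. Suppose that every subproblem with at most \<open>DIM('e)\<close> constraints has value at most
  \<open>c\<close>. Consider the sublevel set of the objective at height \<open>c\<close> together with the constraint sets.
  Among \<open>DIM('e) + 1\<close> of these sets, either the sublevel set occurs, and then at most \<open>DIM('e)\<close>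
  constraints remain and the hypothesis gives a common point; or only constraint sets occur, and these
  meet because the full problem is feasible. By Helly all the sets meet, and a common point is feasible
  for the full problem with objective at most \<open>c\<close>. The objective takes the place of one set, which is
  why \<open>DIM('e)\<close> scenarios suffice instead of \<open>DIM('e) + 1\<close>.\<close>

lemma opt_le_if_small:
  assumes small: "\<And>B. \<lbrakk>B \<subseteq> P; finite B; card B \<le> DIM('e)\<rbrakk> \<Longrightarrow> opt B \<le> ereal c"
  shows "opt P \<le> ereal c"
proof -
  define L where "L = {x \<in> S. f x \<le> c}"
  define K where "K p = {x \<in> S. g x p \<le> 0}" for p
  have "\<Inter>(insert L (K ` P)) \<noteq> {}"
  proof (rule Helly_compact)
    fix C assume "C \<in> insert L (K ` P)"
    thus "compact C" "convex C"
      unfolding L_def K_def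
      by (auto intro!: compact_sublevel convex_sublevel cont_f convex_f continuous_on_decision convex_g)
  next
    fix \<G> assume \<G>: "\<G> \<subseteq> insert L (K ` P)" "finite \<G>" "card \<G> \<le> DIM('e) + 1"
    have "\<G> - {L} \<subseteq> K ` P" using \<G> by auto
    then obtain B where B: "B \<subseteq> P" "inj_on K B" "\<G> - {L} = K ` B"
      unfolding subset_image_inj by blast
    show "\<Inter>\<G> \<noteq> {}"
    proof (cases "L \<in> \<G>")
      case True
      have "finite B" using B \<G> by (metis finite_Diff finite_imageD)
      moreover have "card B \<le> DIM('e)"
        using card_image[OF B(2)] \<G> True by (simp add: B(3)[symmetric])
      ultimately have "opt B \<le> ereal c" using small B by blast
      then obtain x where "x \<in> feasible B" "f x \<le> c" using opt_le_iff B by blast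
      hence "x \<in> L" "\<forall>C\<in>K ` B. x \<in> C" unfolding feasible_def L_def K_def by auto
      moreover have "\<G> \<subseteq> insert L (K ` B)" using B(3) by blast
      ultimately have "\<forall>C\<in>\<G>. x \<in> C" by blast
      thus ?thesis by blast
    next
      case False
      hence "\<G> = K ` B" using B by simp
      moreover obtain x where "x \<in> feasible P" using feasible_nonempty by blast
      hence "\<forall>C\<in>K ` B. x \<in> C" using B unfolding feasible_def K_def by auto
      ultimately show ?thesis by blast
    qed
  qed
  then obtain x where "x \<in> L" "\<forall>p\<in>P. x \<in> K p" by auto
  thus ?thesis
    unfolding opt_le_iff[OF subset_refl] by (auto simp: L_def K_def feasible_def)
qed

definition scenario_opt :: "'p^'n::finite \<Rightarrow> ereal" where
  "scenario_opt a = opt (range (($) a))"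

lemma scenario_subset: "a \<in> tuples P \<Longrightarrow> range (($) a) \<subseteq> P"
  by (auto simp: tuples_def)

lemma scenario_opt_real:
  assumes "a \<in> tuples P" shows "ereal (real_of_ereal (scenario_opt a)) = scenario_opt a"
  unfolding scenario_opt_def using opt_attained[OF scenario_subset[OF assms]]
  by (metis real_of_ereal.simps(1))

text \<open>The set where the value is below \<open>c\<close> is a union, over decisions with objective below \<open>c\<close>, of sets
  cut out by strict inequalities; this is where the Slater point enters. The set where the value is at
  most \<open>c\<close> is the projection of a compact set of pairs of a decision and a tuple.\<close>

lemma continuous_on_scenario_opt:
  "continuous_on (tuples P) (\<lambda>a::'p^'n::finite. real_of_ereal (scenario_opt a))"
proof (rule continuous_on_halflinesI)
  fix c :: real
  let ?v = "\<lambda>a::'p^'n. real_of_ereal (scenario_opt a)"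
  have cont_i: "continuous_on (tuples P) (\<lambda>a::'p^'n. g x (a $ i))" if "x \<in> S" for x and i :: 'n
    by (rule continuous_on_compose2[OF continuous_on_parameter[OF that]])
      (auto intro!: continuous_intros simp: tuples_def)
  have v: "scenario_opt a = ereal (?v a)" if "a \<in> tuples P" for a
    using scenario_opt_real[OF that] by simp
  have v_le: "?v a \<le> c \<longleftrightarrow> (\<exists>x\<in>feasible (range (($) a)). f x \<le> c)"
    and v_less: "?v a < c \<longleftrightarrow> (\<exists>x\<in>S. f x < c \<and> (\<forall>i. g x (a $ i) < 0))" if "a \<in> tuples P" for a
  proof -
    have "?v a \<le> c \<longleftrightarrow> scenario_opt a \<le> ereal c" "?v a < c \<longleftrightarrow> scenario_opt a < ereal c"
      using v[OF that] by (metis ereal_less_eq(3), metis less_ereal.simps(1))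
    thus "?v a \<le> c \<longleftrightarrow> (\<exists>x\<in>feasible (range (($) a)). f x \<le> c)"
      "?v a < c \<longleftrightarrow> (\<exists>x\<in>S. f x < c \<and> (\<forall>i. g x (a $ i) < 0))"
      using opt_le_iff[OF scenario_subset[OF that], of c] opt_less_iff[OF scenario_subset[OF that], of c]
      by (simp_all add: scenario_opt_def)
  qed
  have "{a\<in>tuples P. ?v a < c}
      = (\<Union>x\<in>{x\<in>S. f x < c}. {a\<in>tuples P. \<forall>i. g x (a $ i) < 0})" (is "_ = (\<Union>x\<in>_. ?U x)")
    using v_less by blast
  moreover have "openin (top_of_set (tuples P)) (?U x)" if "x \<in> S" for x
  proof -
    have "?U x = (\<Inter>i. {a\<in>tuples P. g x (a $ i) < 0})" by auto
    moreover have "openin (top_of_set (tuples P)) {a\<in>tuples P. g x (a $ i) < 0}" for i :: 'n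
      using continuous_openin_preimage_gen[OF cont_i[OF that] open_lessThan, of i 0]
      by (simp add: vimage_def Int_def)
    ultimately show ?thesis by (auto intro!: openin_INT2)
  qed
  ultimately show "openin (top_of_set (tuples P)) {a\<in>tuples P. ?v a < c}" by (auto intro!: openin_Union)
  let ?Z = "{(x, a::'p^'n) \<in> S \<times> tuples P. f x \<le> c \<and> (\<forall>i. g x (a $ i) \<le> 0)}"
  have "{a\<in>tuples P. ?v a \<le> c} = snd ` ?Z"
    using v_le by (force simp: feasible_def image_iff)
  moreover have "compact ?Z"
  proof -
    let ?D = "S \<times> (tuples P :: ('p^'n) set)"
    have compact_D: "compact ?D" by (intro compact_Times compact_S compact_tuples compact_P)
    note closed_le = continuous_on_closed_Collect_le[OF _ continuous_on_const compact_imp_closed[OF compact_D]]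
    have "continuous_on ?D (\<lambda>z. f (fst z))"
      by (rule continuous_on_compose2[OF cont_f]) (auto intro!: continuous_intros)
    moreover have "continuous_on ?D (\<lambda>z. g (fst z) (snd z $ i))" for i
      by (rule continuous_on_compose2[OF cont_g, of ?D "\<lambda>z. (fst z, snd z $ i)", unfolded case_prod_conv])
        (auto intro!: continuous_intros simp: tuples_def)
    ultimately have "closed ({z\<in>?D. f (fst z) \<le> c} \<inter> (\<Inter>i. {z\<in>?D. g (fst z) (snd z $ i) \<le> 0}))"
      by (intro closed_Int closed_INT ballI closed_le)
    from compact_Int_closed[OF compact_D this] show ?thesis
      by (rule back_subst[of compact]) auto
  qed
  ultimately have "compact {a\<in>tuples P. ?v a \<le> c}"
    by (simp add: compact_continuous_image continuous_on_snd continuous_on_id)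
  thus "closedin (top_of_set (tuples P)) {a\<in>tuples P. ?v a \<le> c}"
    by (intro closed_subset compact_imp_closed) auto
qed

text \<open>Since \<open>scenario_opt\<close> is continuous on a compact set, it has a maximiser. A set of at most \<open>DIM('e)\<close>
  parameters can be listed in a tuple, so its value is bounded by the maximum, and
  \<open>opt_le_if_small\<close> passes this bound on to the full problem.\<close>

theorem optimal_scenario:
  assumes dim: "DIM('e) \<le> CARD('n::finite)"
  obtains a :: "'p^'n" where "a \<in> tuples P" "\<And>a' :: 'p^'n. a' \<in> tuples P \<Longrightarrow> scenario_opt a' \<le> scenario_opt a"
    "opt P = scenario_opt a"
proof -
  obtain p0 where p0: "p0 \<in> P" using P_nonempty by blast
  have "(\<chi> i. p0) \<in> (tuples P :: ('p^'n) set)" using p0 by (simp add: tuples_def)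
  hence "tuples P \<noteq> ({} :: ('p^'n) set)" by blast
  from continuous_attains_sup[OF compact_tuples[OF compact_P] this continuous_on_scenario_opt]
  obtain a :: "'p^'n" where a: "a \<in> tuples P"
    and max: "\<And>a'::'p^'n. a' \<in> tuples P \<Longrightarrow> real_of_ereal (scenario_opt a') \<le> real_of_ereal (scenario_opt a)"
    by blast
  have max': "scenario_opt a' \<le> scenario_opt a" if "a' \<in> tuples P" for a' :: "'p^'n"
    using max[OF that] scenario_opt_real[OF that] scenario_opt_real[OF a] by (metis ereal_less_eq(3))
  have "opt P \<le> ereal (real_of_ereal (scenario_opt a))"
  proof (rule opt_le_if_small)
    fix B assume B: "B \<subseteq> P" "finite B" "card B \<le> DIM('e)"
    have "card B \<le> card (UNIV :: 'n set)" using B(3) dim by simp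
    with B(2) obtain j :: "'p \<Rightarrow> 'n" where j: "inj_on j B"
      using card_le_inj[of B "UNIV :: 'n set"] by auto
    \<comment> \<open>positions of the tuple that are not needed to list \<open>B\<close> are filled with \<open>p0\<close>\<close>
    define a' :: "'p^'n" where "a' = (\<chi> i. if i \<in> j ` B then inv_into B j i else p0)"
    have "a' \<in> tuples P"
      using B(1) p0 inv_into_into[of _ j B] by (auto simp: tuples_def a'_def)
    moreover have "p = a' $ j p" if "p \<in> B" for p using that j by (simp add: a'_def)
    hence "B \<subseteq> range (($) a')" by blast
    hence "opt B \<le> scenario_opt a'" unfolding scenario_opt_def by (rule opt_mono)
    ultimately show "opt B \<le> ereal (real_of_ereal (scenario_opt a))"
      using max' by (simp add: scenario_opt_real[OF a] order_trans)
  qed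
  moreover have "scenario_opt a \<le> opt P"
    unfolding scenario_opt_def by (intro opt_mono scenario_subset a)
  ultimately have "opt P = scenario_opt a" by (simp add: scenario_opt_real[OF a])
  with a max' show ?thesis by (rule that)
qed

end

section \<open>Continuity of the matrix exponential\<close>

lemma bilinear_matrix_mult:
  "bilinear ((**) :: real^'n^'m \<Rightarrow> real^'k^'n \<Rightarrow> real^'k^'m)"
  unfolding bilinear_def
  by (intro conjI allI linearI)
    (simp_all add: matrix_matrix_mult_def vec_eq_iff distrib_left distrib_right sum.distrib
      sum_distrib_left mult.assoc mult.left_commute)

lemma bounded_bilinear_matrix_mult:
  "bounded_bilinear ((**) :: real^'n^'m \<Rightarrow> real^'k^'n \<Rightarrow> real^'k^'m)"
  using bilinear_matrix_mult bilinear_conv_bounded_bilinear by blast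

lemma bounded_bilinear_matrix_vector_mult:
  "bounded_bilinear ((*v) :: real^'n^'m \<Rightarrow> real^'n \<Rightarrow> real^'m)"
  unfolding bilinear_conv_bounded_bilinear[symmetric] bilinear_def
  by (intro conjI allI linearI)
    (simp_all add: matrix_vector_mult_def vec_eq_iff distrib_left distrib_right sum.distrib
      sum_distrib_left mult.assoc mult.left_commute)

text \<open>Boundedness of a bilinear product gives submultiplicativity of the norm up to a constant \<open>C\<close>,
  hence the geometric rate \<open>C * r\<close>. After division by factorials this is an exponential series, which
  majorises the series of \<open>mat_exp\<close> uniformly on bounded sets.\<close>

lemma matrix_power_norm_bound:
  fixes M :: "real^'d^'d"
  assumes "C > 0" "\<And>(M :: real^'d^'d) (N :: real^'d^'d). norm (M ** N) \<le> norm M * norm N * C" "norm M \<le> r"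
  shows "norm (((**) M ^^ k) (mat 1)) \<le> (C * r) ^ k * norm (mat 1 :: real^'d^'d)"
proof (induction k)
  case 0
  show ?case by simp
next
  case (Suc k)
  have "norm (((**) M ^^ Suc k) (mat 1)) = norm (M ** (((**) M ^^ k) (mat 1)))"
    by (simp only: funpow.simps o_apply)
  also have "\<dots> \<le> norm M * norm (((**) M ^^ k) (mat 1)) * C" by (rule assms)
  also have "\<dots> \<le> r * ((C * r) ^ k * norm (mat 1 :: real^'d^'d)) * C"
  proof (intro mult_right_mono mult_mono)
    show "0 \<le> r" using assms(3) norm_ge_zero[of M] by linarith
  qed (use assms Suc.IH in auto)
  finally show ?case by (simp add: mult_ac)
qed

lemma continuous_on_matrix_power:
  "continuous_on X (\<lambda>M :: real^'d^'d. ((**) M ^^ k) (mat 1))"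
proof (induction k)
  case (Suc k)
  thus ?case by (auto intro!: bounded_bilinear.continuous_on[OF bounded_bilinear_matrix_mult] continuous_on_id)
qed simp
lemma continuous_on_mat_exp: "continuous_on UNIV (mat_exp :: real^'d^'d \<Rightarrow> real^'d^'d)"
proof -
  obtain C where C: "C > 0" "\<And>(M :: real^'d^'d) (N :: real^'d^'d). norm (M ** N) \<le> norm M * norm N * C"
    using bounded_bilinear.pos_bounded[OF bounded_bilinear_matrix_mult[where 'm='d and 'n='d and 'k='d]]
    by blast
  have ball: "continuous_on (ball 0 r) (mat_exp :: real^'d^'d \<Rightarrow> _)" for r
  proof -
    have lim: "uniform_limit (ball 0 r) (\<lambda>n M :: real^'d^'d. \<Sum>k<n. ((**) M ^^ k) (mat 1) /\<^sub>R fact k)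
        (\<lambda>M. \<Sum>k. ((**) M ^^ k) (mat 1) /\<^sub>R fact k) sequentially"
    proof (rule Weierstrass_m_test)
      fix k and M :: "real^'d^'d" assume "M \<in> ball 0 r"
      hence "norm (((**) M ^^ k) (mat 1)) \<le> (C * r) ^ k * norm (mat 1 :: real^'d^'d)"
        by (intro matrix_power_norm_bound C) simp
      thus "norm (((**) M ^^ k) (mat 1) /\<^sub>R fact k) \<le> (C * r) ^ k /\<^sub>R fact k * norm (mat 1 :: real^'d^'d)"
        by (simp add: divide_simps)
    qed (intro summable_mult2 summable_exp_generic)
    have cont: "\<forall>\<^sub>F n in sequentially.
        continuous_on (ball 0 r) (\<lambda>M :: real^'d^'d. \<Sum>k<n. ((**) M ^^ k) (mat 1) /\<^sub>R fact k)"
      by (intro always_eventually allI continuous_on_sum continuous_on_scaleR continuous_on_const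
          continuous_on_matrix_power)
    have "continuous_on (ball 0 r) (\<lambda>M :: real^'d^'d. \<Sum>k. ((**) M ^^ k) (mat 1) /\<^sub>R fact k)"
      by (rule uniform_limit_theorem[OF cont lim]) simp
    thus ?thesis by (simp add: mat_exp_def[abs_def])
  qed
  have "isCont mat_exp M" for M :: "real^'d^'d"
    using ball[of "norm M + 1"] continuous_on_eq_continuous_at[OF open_ball, of 0 "norm M + 1"]
    by (metis add.commute dist_0_norm less_add_one mem_ball)
  thus ?thesis by (simp add: continuous_at_imp_continuous_on)
qed

section \<open>Integration against step functions\<close>

definition step_function :: "(nat \<Rightarrow> real) \<Rightarrow> nat \<Rightarrow> real \<Rightarrow> (real \<Rightarrow> real) \<Rightarrow> bool" where
  "step_function t K T u \<longleftrightarrow> (\<forall>k\<in>{1..K}. u constant_on {t (k - 1)..<t k}) \<and> u constant_on {t K..T}"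

lemma integrable_constant_on_scaleR:
  fixes F :: "real \<Rightarrow> 'a::euclidean_space"
  assumes "u constant_on {a..<b}" "continuous_on {a..b} F"
  shows "(\<lambda>s. u s *\<^sub>R F s) integrable_on {a..b}"
proof -
  obtain c where c: "\<And>s. s \<in> {a..<b} \<Longrightarrow> u s = c" using assms(1) by (auto simp: constant_on_def)
  show ?thesis
  proof (rule integrable_spike_finite)
    show "(\<lambda>s. c *\<^sub>R F s) integrable_on {a..b}"
      using assms by (intro integrable_continuous_interval continuous_intros)
    show "finite {b}" by simp
    show "u s *\<^sub>R F s = c *\<^sub>R F s" if "s \<in> {a..b} - {b}" for s using c[of s] that by auto
  qed
qed

text \<open>The integrand agrees with a continuous function on each grid interval except at its right end point,
  and integrability is additive over adjacent intervals.\<close>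

lemma step_function_integrable_scaleR:
  fixes F :: "real \<Rightarrow> 'a::euclidean_space"
  assumes mono: "\<And>k. k \<in> {1..K} \<Longrightarrow> t (k - 1) < t k" and "t K \<le> T"
    and u: "step_function t K T u" and F: "continuous_on {t 0..T} F"
  shows "(\<lambda>s. u s *\<^sub>R F s) integrable_on {t 0..T}"
proof -
  have up: "t 0 \<le> t k \<and> (\<lambda>s. u s *\<^sub>R F s) integrable_on {t 0..t k}" if "k \<le> K" "t k \<le> T" for k
    using that
  proof (induction k)
    case 0
    show ?case using integrable_on_refl[of _ "t 0"] by simp
  next
    case (Suc k)
    have less: "t k < t (Suc k)" using mono[of "Suc k"] Suc.prems by simp
    with Suc have IH: "t 0 \<le> t k" "(\<lambda>s. u s *\<^sub>R F s) integrable_on {t 0..t k}" by auto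
    have "u constant_on {t k..<t (Suc k)}" using u Suc.prems unfolding step_function_def by force
    moreover have "continuous_on {t k..t (Suc k)} F"
      using IH Suc.prems by (intro continuous_on_subset[OF F]) auto
    ultimately have "(\<lambda>s. u s *\<^sub>R F s) integrable_on {t k..t (Suc k)}"
      by (rule integrable_constant_on_scaleR)
    thus ?case
      using IH less Henstock_Kurzweil_Integration.integrable_combine[of "t 0" "t k" "t (Suc k)"] by auto
  qed
  have "(\<lambda>s. u s *\<^sub>R F s) integrable_on {t K..T}"
  proof (rule integrable_constant_on_scaleR)
    show "u constant_on {t K..<T}" using u unfolding step_function_def constant_on_def by auto
    show "continuous_on {t K..T} F" using up[of K] \<open>t K \<le> T\<close> by (intro continuous_on_subset[OF F]) auto
  qed
  thus ?thesis using up[of K] \<open>t K \<le> T\<close>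
    by (auto intro: Henstock_Kurzweil_Integration.integrable_combine[of "t 0" "t K" T])
qed

lemma step_function_linear_comb:
  assumes "\<And>i. i \<in> I \<Longrightarrow> step_function t K T (u i)"
  shows "step_function t K T (\<lambda>s. \<Sum>i\<in>I. c i * u i s)"
proof -
  have "(\<lambda>s. \<Sum>i\<in>I. c i * u i s) constant_on X" if const: "\<And>i. i \<in> I \<Longrightarrow> u i constant_on X" for X
  proof -
    obtain y where "\<And>i x. i \<in> I \<Longrightarrow> x \<in> X \<Longrightarrow> u i x = y i"
    proof (rule that)
      fix i x assume "i \<in> I" "x \<in> X"
      thus "u i x = (SOME c. \<forall>x\<in>X. u i x = c)"
        using const[of i] someI_ex[of "\<lambda>c. \<forall>x\<in>X. u i x = c"] unfolding constant_on_def by blast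
    qed
    thus ?thesis unfolding constant_on_def by (auto intro!: exI[of _ "\<Sum>i\<in>I. c i * y i"] sum.cong)
  qed
  thus ?thesis using assms unfolding step_function_def by blast
qed

lemma step_function_compose:
  assumes "step_function t K T u"
  shows "step_function t K T (\<lambda>s. w (u s))"
proof -
  have "(\<lambda>s. w (u s)) constant_on X" if "u constant_on X" for X
    using that unfolding constant_on_def by metis
  thus ?thesis using assms unfolding step_function_def by blast
qed

text \<open>Continuity of a parametric integral whose weight \<open>u\<close> may jump: dominated convergence along sequences,
  with a multiple of \<open>\<bar>u\<bar>\<close> as majorant.\<close>

lemma continuous_on_weighted_integral:
  fixes F :: "'p::metric_space \<Rightarrow> real \<Rightarrow> 'a::euclidean_space"
  assumes P: "compact P" and F: "continuous_on (P \<times> {a..b}) (\<lambda>(p, s). F p s)"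
    and int: "\<And>p. p \<in> P \<Longrightarrow> (\<lambda>s. u s *\<^sub>R F p s) integrable_on {a..b}"
    and abs: "(\<lambda>s. \<bar>u s\<bar>) integrable_on {a..b}"
  shows "continuous_on P (\<lambda>p. integral {a..b} (\<lambda>s. u s *\<^sub>R F p s))"
  unfolding continuous_on_sequentially
proof (intro allI ballI impI, unfold o_def)
  fix p0 and p :: "nat \<Rightarrow> 'p" assume p: "p0 \<in> P" "(\<forall>n. p n \<in> P) \<and> p \<longlonglongrightarrow> p0"
  have "compact ((\<lambda>(p, s). F p s) ` (P \<times> {a..b}))"
    by (intro compact_continuous_image F compact_Times P compact_Icc)
  then obtain B where B: "\<And>q s. q \<in> P \<Longrightarrow> s \<in> {a..b} \<Longrightarrow> norm (F q s) \<le> B"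
    by (metis (no_types, lifting) SigmaI bounded_iff case_prod_conv compact_imp_bounded image_eqI)
  show "(\<lambda>n. integral {a..b} (\<lambda>s. u s *\<^sub>R F (p n) s)) \<longlonglongrightarrow> integral {a..b} (\<lambda>s. u s *\<^sub>R F p0 s)"
  proof (rule dominated_convergence(2))
    show "(\<lambda>s. u s *\<^sub>R F (p n) s) integrable_on {a..b}" for n using int p by blast
    show "(\<lambda>s. \<bar>u s\<bar> * B) integrable_on {a..b}" using abs by (rule integrable_on_mult_left)
    show "norm (u s *\<^sub>R F (p n) s) \<le> \<bar>u s\<bar> * B" if "s \<in> {a..b}" for n s
      using B[of "p n" s] that p by (simp add: mult_left_mono)
    show "(\<lambda>n. u s *\<^sub>R F (p n) s) \<longlonglongrightarrow> u s *\<^sub>R F p0 s" if s: "s \<in> {a..b}" for s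
    proof -
      have "continuous_on P (\<lambda>q. F q s)"
        by (rule continuous_on_compose2[OF F, of P "\<lambda>q. (q, s)", unfolded case_prod_conv])
          (use s in \<open>auto intro!: continuous_intros\<close>)
      hence "(\<lambda>n. F (p n) s) \<longlonglongrightarrow> F p0 s"
        using p unfolding continuous_on_sequentially o_def by blast
      thus ?thesis by (intro tendsto_intros)
    qed
  qed
qed

section \<open>The set of admissible controls\<close>

lemma ctrl_eq_sum: "ctrl \<phi> \<Theta> s = (\<Sum>i\<in>UNIV. \<Theta> $ i * \<phi> i s)"
  by (simp add: ctrl_def Phi_def inner_vec_def)

text \<open>Independence of the basis functions as functions on \<open>X\<close> means that no nonzero vector is orthogonal to
  all values of \<open>Phi\<close> on \<open>X\<close>.\<close>

lemma span_Phi: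
  assumes "lin_indep_on X \<phi>" shows "span (Phi \<phi> ` X) = UNIV"
proof (rule ccontr)
  assume "span (Phi \<phi> ` X) \<noteq> UNIV"
  then obtain c where c: "c \<noteq> 0" "\<And>y. y \<in> span (Phi \<phi> ` X) \<Longrightarrow> orthogonal c y"
    using orthogonal_to_subspace_exists_gen[of "Phi \<phi> ` X" UNIV] by auto
  have "(\<Sum>i\<in>UNIV. c $ i * \<phi> i s) = 0" if "s \<in> X" for s
    using c(2)[OF span_base, of "Phi \<phi> s"] that
    by (simp add: orthogonal_def ctrl_eq_sum flip: ctrl_def)
  hence "\<forall>i. c $ i = 0" using assms unfolding lin_indep_on_def by blast
  thus False using c(1) by (simp add: vec_eq_iff)
qed

text \<open>Each bound in \<open>Xi\<close> limits \<open>\<Theta>\<close> along one vector \<open>Phi \<phi> s\<close>. These vectors span, so \<open>\<Theta>\<close> is bounded along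
  every direction.\<close>

lemma compact_Xi:
  assumes "lin_indep_on {0..T} \<phi>" shows "compact (Xi T \<phi>)"
proof -
  have "Xi T \<phi> = (\<Inter>s\<in>{0..T}. {\<Theta>. \<Theta> \<bullet> Phi \<phi> s \<in> {-1..1}})"
    by (auto simp: Xi_def ctrl_def)
  moreover have "closed {\<Theta>. \<Theta> \<bullet> v \<in> {-1..1}}" for v :: "real^'a"
    by (intro closed_vimage[of "{-1..1}", unfolded vimage_def] continuous_intros closed_atLeastAtMost)
  ultimately have "closed (Xi T \<phi>)" by auto
  moreover have "\<exists>r. \<forall>\<Theta>\<in>Xi T \<phi>. \<bar>\<Theta> \<bullet> e\<bar> \<le> r" for e
  proof -
    have "e \<in> span (Phi \<phi> ` {0..T})" using span_Phi[OF assms] by simp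
    thus ?thesis
    proof (induction rule: span_induct_alt)
      case base
      show ?case by auto
    next
      case (step c x y)
      then obtain r s where r: "\<forall>\<Theta>\<in>Xi T \<phi>. \<bar>\<Theta> \<bullet> y\<bar> \<le> r" and s: "s \<in> {0..T}" "x = Phi \<phi> s" by blast
      have "\<bar>\<Theta> \<bullet> (c *\<^sub>R x + y)\<bar> \<le> \<bar>c\<bar> + r" if "\<Theta> \<in> Xi T \<phi>" for \<Theta>
      proof -
        have "\<bar>\<Theta> \<bullet> x\<bar> \<le> 1" using that s by (auto simp: Xi_def ctrl_def abs_le_iff)
        hence "\<bar>c * (\<Theta> \<bullet> x)\<bar> \<le> \<bar>c\<bar>" by (simp add: abs_mult mult_left_le)
        moreover have "\<bar>\<Theta> \<bullet> y\<bar> \<le> r" using r that by blast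
        ultimately show ?thesis by (simp add: inner_add_right)
      qed
      thus ?case by blast
    qed
  qed
  then obtain r where r: "\<And>e \<Theta>. \<Theta> \<in> Xi T \<phi> \<Longrightarrow> \<bar>\<Theta> \<bullet> e\<bar> \<le> r e" by metis
  have "norm \<Theta> \<le> (\<Sum>e\<in>Basis. r e)" if "\<Theta> \<in> Xi T \<phi>" for \<Theta>
    using norm_le_l1[of \<Theta>] r[OF that] by (meson order_trans sum_mono)
  hence "bounded (Xi T \<phi>)" by (auto simp: bounded_iff)
  ultimately show ?thesis by (simp add: compact_eq_bounded_closed)
qed

lemma convex_Xi: "convex (Xi T \<phi>)"
proof -
  have "Xi T \<phi> = (\<Inter>s\<in>{0..T}. {\<Theta>. \<Theta> \<bullet> Phi \<phi> s \<in> {-1..1}})"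
    by (auto simp: Xi_def ctrl_def)
  moreover have "convex {\<Theta>. \<Theta> \<bullet> v \<in> {-1..1}}" for v :: "real^'a"
    using convex_Int[OF convex_halfspace_ge[of "-1" v] convex_halfspace_le[of v 1]]
    by (simp add: Int_def inner_commute)
  ultimately show ?thesis by (auto intro: convex_INT)
qed

section \<open>Cost and terminal state of the controlled system\<close>

lemma C1_on_imp_continuous_on: "C1_on f U \<Longrightarrow> continuous_on U f"
  unfolding C1_on_def by (meson continuous_at_imp_continuous_on has_derivative_continuous)

locale step_controls =
  fixes t :: "nat \<Rightarrow> real" and K :: nat and T :: real and \<phi> :: "'N::finite \<Rightarrow> real \<Rightarrow> real"
  assumes grid_start: "t 0 = 0" and grid_mono: "\<And>k. k \<in> {1..K} \<Longrightarrow> t (k - 1) < t k"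
    and grid_end: "t K \<le> T" and step: "\<And>i. step_function t K T (\<phi> i)"
begin

lemma integrable_basis_scaleR:
  fixes F :: "real \<Rightarrow> 'a::euclidean_space"
  shows "continuous_on {0..T} F \<Longrightarrow> (\<lambda>s. \<phi> i s *\<^sub>R F s) integrable_on {0..T}"
  using step_function_integrable_scaleR[OF grid_mono grid_end step, of F i] grid_start by simp

lemma integrable_abs_step:
  assumes "step_function t K T u" shows "(\<lambda>s. \<bar>u s\<bar>) integrable_on {0..T}"
  using step_function_integrable_scaleR[OF grid_mono grid_end step_function_compose[OF assms],
      of "\<lambda>_. 1 :: real" abs] grid_start by simp

lemma integrable_abs_ctrl: "(\<lambda>s. \<bar>ctrl \<phi> \<Theta> s\<bar>) integrable_on {0..T}"
  using integrable_abs_step[OF step_function_linear_comb[of UNIV t K T \<phi> "\<lambda>i. \<Theta> $ i"]] step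
  by (simp add: ctrl_eq_sum)

lemma ctrl_convex_comb:
  "ctrl \<phi> (a *\<^sub>R \<Theta> + c *\<^sub>R \<Theta>') s = a * ctrl \<phi> \<Theta> s + c * ctrl \<phi> \<Theta>' s"
  by (simp add: ctrl_def inner_add_left)

lemma convex_on_J1: "convex_on UNIV (\<lambda>\<Theta>. J1 T (ctrl \<phi> \<Theta>))"
proof (rule convex_onI)
  fix s :: real and x y :: "real^'N" assume s: "0 < s" "s < 1"
  have "J1 T (ctrl \<phi> ((1 - s) *\<^sub>R x + s *\<^sub>R y))
      \<le> integral {0..T} (\<lambda>r. (1 - s) * \<bar>ctrl \<phi> x r\<bar> + s * \<bar>ctrl \<phi> y r\<bar>)"
    unfolding J1_def
  proof (rule integral_le)
    show "(\<lambda>r. (1 - s) * \<bar>ctrl \<phi> x r\<bar> + s * \<bar>ctrl \<phi> y r\<bar>) integrable_on {0..T}"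
      by (intro integrable_add integrable_on_mult_right integrable_abs_ctrl)
    show "\<bar>ctrl \<phi> ((1 - s) *\<^sub>R x + s *\<^sub>R y) r\<bar> \<le> (1 - s) * \<bar>ctrl \<phi> x r\<bar> + s * \<bar>ctrl \<phi> y r\<bar>" for r
      using abs_triangle_ineq[of "(1 - s) * ctrl \<phi> x r" "s * ctrl \<phi> y r"] s
      by (simp add: ctrl_convex_comb abs_mult)
  qed (rule integrable_abs_ctrl)
  also have "\<dots> = (1 - s) * J1 T (ctrl \<phi> x) + s * J1 T (ctrl \<phi> y)"
    unfolding J1_def
    by (subst integral_add) (simp_all add: integrable_on_mult_right integrable_abs_ctrl)
  finally show "J1 T (ctrl \<phi> ((1 - s) *\<^sub>R x + s *\<^sub>R y)) \<le> (1 - s) * J1 T (ctrl \<phi> x) + s * J1 T (ctrl \<phi> y)" .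
qed simp

lemma continuous_on_J1: "continuous_on X (\<lambda>\<Theta>. J1 T (ctrl \<phi> \<Theta>))"
  using convex_on_continuous[OF open_UNIV convex_on_J1] by (rule continuous_on_subset) simp

text \<open>The terminal state reached from the origin with the \<open>i\<close>-th basis function as control.\<close>

definition response :: "('p \<Rightarrow> real^'d^'d) \<Rightarrow> ('p \<Rightarrow> real^'d) \<Rightarrow> 'N \<Rightarrow> 'p \<Rightarrow> real^'d" where
  "response A b i \<alpha> = integral {0..T} (\<lambda>s. \<phi> i s *\<^sub>R (mat_exp ((T - s) *\<^sub>R A \<alpha>) *v b \<alpha>))"

lemma continuous_on_propagator:
  fixes A :: "'p::topological_space \<Rightarrow> real^'d^'d"
  assumes "continuous_on P A" "continuous_on P b"
  shows "continuous_on (P \<times> X) (\<lambda>(\<alpha>, s). mat_exp ((T - s) *\<^sub>R A \<alpha>) *v b \<alpha>)"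
proof -
  have "continuous_on (P \<times> X) (\<lambda>z. A (fst z))" "continuous_on (P \<times> X) (\<lambda>z. b (fst z))"
    by (rule continuous_on_compose2[OF assms(1)] continuous_on_compose2[OF assms(2)];
        auto intro!: continuous_intros)+
  thus ?thesis
    unfolding case_prod_unfold
    by (intro bounded_bilinear.continuous_on[OF bounded_bilinear_matrix_vector_mult]
        continuous_on_compose2[OF continuous_on_mat_exp _ subset_UNIV] continuous_intros)
qed

lemma integrable_response: "(\<lambda>s. \<phi> i s *\<^sub>R (mat_exp ((T - s) *\<^sub>R M) *v v)) integrable_on {0..T}"
proof (rule integrable_basis_scaleR)
  show "continuous_on {0..T} (\<lambda>s. mat_exp ((T - s) *\<^sub>R M) *v v)"
    by (intro bounded_bilinear.continuous_on[OF bounded_bilinear_matrix_vector_mult]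
        continuous_on_compose2[OF continuous_on_mat_exp _ subset_UNIV] continuous_intros)
qed

text \<open>For a fixed parameter the terminal state is affine in \<open>\<Theta>\<close>, with coefficients that depend on the
  parameter alone. Joint continuity and convexity of the terminal constraint are read off from this.\<close>

lemma traj_eq:
  "traj A b \<phi> x0 \<Theta> T \<alpha> = mat_exp (T *\<^sub>R A \<alpha>) *v x0 + (\<Sum>i\<in>UNIV. \<Theta> $ i *\<^sub>R response A b i \<alpha>)"
proof -
  let ?E = "\<lambda>s. mat_exp ((T - s) *\<^sub>R A \<alpha>) *v b \<alpha>"
  have "integral {0..T} (\<lambda>s. ctrl \<phi> \<Theta> s *\<^sub>R ?E s)
      = integral {0..T} (\<lambda>s. \<Sum>i\<in>UNIV. \<Theta> $ i *\<^sub>R \<phi> i s *\<^sub>R ?E s)"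
    by (simp add: ctrl_eq_sum scaleR_sum_left)
  also have "\<dots> = (\<Sum>i\<in>UNIV. integral {0..T} (\<lambda>s. \<Theta> $ i *\<^sub>R \<phi> i s *\<^sub>R ?E s))"
    by (intro integral_sum integrable_cmul integrable_response finite)
  also have "\<dots> = (\<Sum>i\<in>UNIV. \<Theta> $ i *\<^sub>R response A b i \<alpha>)"
    by (simp only: integral_cmul response_def)
  finally show ?thesis by (simp add: traj_def)
qed

lemma continuous_on_response:
  fixes A :: "'p::metric_space \<Rightarrow> real^'d^'d"
  assumes "compact P" "continuous_on P A" "continuous_on P b"
  shows "continuous_on P (response A b i)"
  unfolding response_def[abs_def]
  by (intro continuous_on_weighted_integral assms continuous_on_propagator integrable_response
      integrable_abs_step step)

lemma continuous_on_traj: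
  fixes A :: "'p::metric_space \<Rightarrow> real^'d^'d"
  assumes "compact P" "continuous_on P A" "continuous_on P b"
  shows "continuous_on (X \<times> P) (\<lambda>(\<Theta>, \<alpha>). traj A b \<phi> x0 \<Theta> T \<alpha>)"
proof -
  have "continuous_on (X \<times> P) (\<lambda>z. A (snd z))"
    by (rule continuous_on_compose2[OF assms(2)]) (auto intro!: continuous_intros)
  moreover have "continuous_on (X \<times> P) (\<lambda>z. response A b i (snd z))" for i
    by (rule continuous_on_compose2[OF continuous_on_response[OF assms]]) (auto intro!: continuous_intros)
  ultimately show ?thesis
    unfolding case_prod_unfold traj_eq
    by (intro bounded_bilinear.continuous_on[OF bounded_bilinear_matrix_vector_mult]
        continuous_on_compose2[OF continuous_on_mat_exp _ subset_UNIV] continuous_intros)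
qed

lemma traj_convex_comb:
  "traj A b \<phi> x0 ((1 - s) *\<^sub>R x + s *\<^sub>R y) T \<alpha>
    = (1 - s) *\<^sub>R traj A b \<phi> x0 x T \<alpha> + s *\<^sub>R traj A b \<phi> x0 y T \<alpha>"
  by (simp add: traj_eq sum.distrib sum_subtractf algebra_simps scaleR_sum_right)

lemma convex_on_terminal_constraint:
  assumes "convex_on UNIV \<psi>" "convex X"
  shows "convex_on X (\<lambda>\<Theta>. \<psi> (traj A b \<phi> x0 \<Theta> T \<alpha>))"
proof (rule convex_onI)
  fix s :: real and x y :: "real^'N" assume "0 < s" "s < 1"
  thus "\<psi> (traj A b \<phi> x0 ((1 - s) *\<^sub>R x + s *\<^sub>R y) T \<alpha>)
      \<le> (1 - s) * \<psi> (traj A b \<phi> x0 x T \<alpha>) + s * \<psi> (traj A b \<phi> x0 y T \<alpha>)"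
    unfolding traj_convex_comb by (intro convex_onD[OF assms(1)]) auto
qed (fact assms(2))

end

section \<open>Robust value and scenario values\<close>

theorem theorem3p10:
  fixes T h :: real and K :: nat and t :: "nat \<Rightarrow> real"
    and \<A> :: "(real^'nu) set"
    and A :: "real^'nu \<Rightarrow> real^'d^'d" and b :: "real^'nu \<Rightarrow> real^'d"
    and \<psi> :: "real^'d \<Rightarrow> real"
    and \<phi> :: "'N::finite \<Rightarrow> real \<Rightarrow> real"
    and xbar :: "real^'d"
  assumes "T > 0"
    and "\<A> \<noteq> {}" and "compact \<A>" and "convex \<A>"
    and "\<exists>U. open U \<and> \<A> \<subseteq> U \<and> C1_on A U \<and> C1_on b U"
    and "C1_on \<psi> UNIV" and "convex_on UNIV \<psi>"
    and "compact {\<xi>. \<psi> \<xi> \<le> 0}" and "convex {\<xi>. \<psi> \<xi> \<le> 0}"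
    and "h > 0" and "t 0 = 0" and "\<forall>i\<in>{1..K}. t (i - 1) < t i"
    and "\<forall>i\<in>{1..K}. t i - t (i - 1) = h" and "t K \<le> T" and "T - t K \<le> h"
    and "lin_indep_on {0..T} \<phi>"
    and "\<forall>i. \<forall>k\<in>{1..K}. \<phi> i constant_on {t (k - 1)..<t k}"
    and "\<forall>i. \<phi> i constant_on {t K..T}"
    and "(MAX i\<in>UNIV. MAX s\<in>{0..T}. \<bar>\<phi> i s\<bar>) = 1"
    and "X_T T A b \<psi> \<A> \<phi> \<noteq> {}"
    and "xbar \<in> X_T T A b \<psi> \<A> \<phi>"
    and "\<exists>\<Theta>\<in>Xi T \<phi>. \<forall>\<alpha>\<in>\<A>. \<psi> (traj A b \<phi> xbar \<Theta> T \<alpha>) < 0"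
  shows "(\<forall>\<alpha>s\<in>tuples \<A>. \<bar>G T A b \<psi> \<phi> xbar \<alpha>s\<bar> \<noteq> \<infinity>)
    \<and> continuous_on (tuples \<A>) (\<lambda>\<alpha>s. real_of_ereal (G T A b \<psi> \<phi> xbar \<alpha>s))
    \<and> (\<exists>\<alpha>star\<in>tuples \<A>.
          G T A b \<psi> \<phi> xbar \<alpha>star = (SUP \<alpha>s\<in>tuples \<A>. G T A b \<psi> \<phi> xbar \<alpha>s)
        \<and> V T A b \<psi> \<A> \<phi> xbar = G T A b \<psi> \<phi> xbar \<alpha>star)"
proof -
  interpret step_controls t K T \<phi>
    using assms(11,12,14,17,18) by unfold_locales (auto simp: step_function_def)
  have cont_A: "continuous_on \<A> A" and cont_b: "continuous_on \<A> b"
    using assms(5) C1_on_imp_continuous_on continuous_on_subset by metis+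
  let ?g = "\<lambda>\<Theta> \<alpha>. \<psi> (traj A b \<phi> xbar \<Theta> T \<alpha>)"
  interpret compact_convex_program "Xi T \<phi>" "\<lambda>\<Theta>. J1 T (ctrl \<phi> \<Theta>)" \<A> ?g
  proof
    show "compact (Xi T \<phi>)" using assms(16) by (rule compact_Xi)
    show "convex_on (Xi T \<phi>) (\<lambda>\<Theta>. J1 T (ctrl \<phi> \<Theta>))"
      using convex_on_J1 by (rule convex_on_subset) (simp_all add: convex_Xi)
    show "continuous_on (Xi T \<phi> \<times> \<A>) (\<lambda>(\<Theta>, \<alpha>). ?g \<Theta> \<alpha>)"
      using continuous_on_compose2[OF C1_on_imp_continuous_on[OF assms(6)]
          continuous_on_traj[OF assms(3) cont_A cont_b] subset_UNIV]
      by (simp add: case_prod_unfold)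
  qed (use assms in \<open>auto intro: convex_Xi continuous_on_J1 convex_on_terminal_constraint\<close>)
  have V_eq: "V T A b \<psi> \<A> \<phi> xbar = opt \<A>"
    by (simp add: V_def opt_def feasible_def)
  have G_eq: "G T A b \<psi> \<phi> xbar \<alpha>s = scenario_opt \<alpha>s" for \<alpha>s
    by (simp add: G_def scenario_opt_def opt_def feasible_def)
  obtain a :: "(real^'nu)^'N" where a: "a \<in> tuples \<A>"
      "\<And>a' :: (real^'nu)^'N. a' \<in> tuples \<A> \<Longrightarrow> scenario_opt a' \<le> scenario_opt a"
      "opt \<A> = scenario_opt a"
    by (rule optimal_scenario[where 'n='N]) auto
  have "\<bar>scenario_opt a'\<bar> \<noteq> \<infinity>" if "a' \<in> tuples \<A>" for a' :: "(real^'nu)^'N"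
    using scenario_opt_real[OF that] by (metis abs_ereal.simps(1) PInfty_neq_ereal(1))
  moreover have "scenario_opt a = (SUP \<alpha>s\<in>(tuples \<A> :: ((real^'nu)^'N) set). scenario_opt \<alpha>s)"
  proof (rule antisym)
    show "scenario_opt a \<le> (SUP \<alpha>s\<in>(tuples \<A> :: ((real^'nu)^'N) set). scenario_opt \<alpha>s)" using a(1) by (rule SUP_upper)
    show "(SUP \<alpha>s\<in>(tuples \<A> :: ((real^'nu)^'N) set). scenario_opt \<alpha>s) \<le> scenario_opt a"
      using a(2) by (rule SUP_least)
  qed
  ultimately show ?thesis
    unfolding V_eq G_eq using a(3) by (intro conjI ballI bexI[OF _ a(1)] continuous_on_scenario_opt)
qed

end
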